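(* Let $X$ and $Y$ be bounded metric spaces, where $\#Y\ge 2$ (so that the Borsuk number $\beta(Y)$ is defined). Suppose that $\#X<\beta(Y)$ and $\operatorname{diam} X\le\operatorname{diam} Y$. Then $$2\,d_{GH}(X,Y)=\operatorname{diam} Y,$$ where $d_{GH}$ is the Gromov--Hausdorff distance.
   Context: All metric spaces are nonempty, and $\#X$ denotes the cardinality of $X$ (possibly infinite). Gromov--Hausdorff distance: for metric spaces $X,Y$, $d_{GH}(X,Y)$ is the infimum of real numbers $r$ for which there exist a metric space $Z$ and subsets $X',Y'\subset Z$ isometric to $X$ and $Y$, respectively, with Hausdorff distance $d_H(X',Y')\le r$. Equivalently, $d_{GH}(X,Y)=\frac12\inf\{\operatorname{dis}R\}$ over all correspondences $R\subset X\times Y$ (subsets that project onto both $X$ and $Y$), where $\operatorname{dis}R=\sup\{\,||xx'|-|yy'||:(x,y),(x',y')\in R\}$. The spaces are not assumed to be compact. Borsuk number: let $Y$ be a bounded metric space. A partition $\{Y_i\}_{i\in I}$ of $Y$ into nonempty subsets is a partition into subsets of strictly smaller diameter if there exists $\varepsilon>0$ such that $\operatorname{diam} Y_i\le\operatorname{diam} Y-\varepsilon$ for all $i\in I$. For $\#Y\ge2$, the Borsuk number $\beta(Y)$ is the infimum (least) of the cardinal numbers $n$ such that $Y$ can be partitioned into $n$ nonempty subsets of strictly smaller diameter. *)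

theory Defs
  imports "HOL-Analysis.Analysis" "HOL-Library.Disjoint_Sets"
begin

unbundle cardinal_syntax

definition mbounded_of :: "'a metric \<Rightarrow> 'a set \<Rightarrow> bool" where
  "mbounded_of X = Metric_space.mbounded (mspace X) (mdist X)"

text \<open>The counterpart of \<^const>\<open>diameter\<close> for \<^typ>\<open>'a metric\<close>; like it, a real number
  that is meaningful for bounded sets only.\<close>

definition mdiameter :: "'a metric \<Rightarrow> 'a set \<Rightarrow> real" where
  "mdiameter X S = (if S = {} then 0 else SUP (x, y)\<in>S \<times> S. mdist X x y)"

definition isometric_to_subset :: "'a metric \<Rightarrow> 'c metric \<Rightarrow> 'c set \<Rightarrow> bool" where
  "isometric_to_subset X Z S \<longleftrightarrow> S \<subseteq> mspace Z \<and>
     (\<exists>f. bij_betw f (mspace X) S \<and>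
          (\<forall>x\<in>mspace X. \<forall>x'\<in>mspace X. mdist Z (f x) (f x') = mdist X x x'))"

definition hausdorff_dist :: "'a metric \<Rightarrow> 'a set \<Rightarrow> 'a set \<Rightarrow> ereal" where
  "hausdorff_dist Z A B =
     max (SUP a\<in>A. INF b\<in>B. ereal (mdist Z a b)) (SUP b\<in>B. INF a\<in>A. ereal (mdist Z a b))"

text \<open>The ambient space \<^term>\<open>Z\<close> should range over all metric spaces.  Since only the union of
  the two isometric copies matters, it suffices to take carriers inside \<^typ>\<open>'a + 'b\<close>; the
  lemma \<open>gromov_hausdorff_dist_le\<close> below shows that ambient spaces of other types contribute
  nothing new.\<close>

definition gromov_hausdorff_dist :: "'a metric \<Rightarrow> 'b metric \<Rightarrow> ereal" where
  "gromov_hausdorff_dist X Y =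
     Inf {ereal r | r. \<exists>(Z :: ('a + 'b) metric) X' Y'.
            isometric_to_subset X Z X' \<and> isometric_to_subset Y Z Y' \<and>
            hausdorff_dist Z X' Y' \<le> ereal r}"

lemma gromov_hausdorff_dist_le:
  fixes X :: "'a metric" and Y :: "'b metric" and Z :: "'c metric"
  assumes X': "isometric_to_subset X Z X'" and Y': "isometric_to_subset Y Z Y'"
    and r: "hausdorff_dist Z X' Y' \<le> ereal r"
  shows "gromov_hausdorff_dist X Y \<le> ereal r"
proof -
  obtain f where f: "X' \<subseteq> mspace Z" "bij_betw f (mspace X) X'"
    "\<And>x x'. x \<in> mspace X \<Longrightarrow> x' \<in> mspace X \<Longrightarrow> mdist Z (f x) (f x') = mdist X x x'"
    using X' unfolding isometric_to_subset_def by blast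
  obtain g where g: "Y' \<subseteq> mspace Z" "bij_betw g (mspace Y) Y'"
    "\<And>x x'. x \<in> mspace Y \<Longrightarrow> x' \<in> mspace Y \<Longrightarrow> mdist Z (g x) (g x') = mdist Y x x'"
    using Y' unfolding isometric_to_subset_def by blast
  define h :: "'c \<Rightarrow> 'a + 'b" where
    "h z = (if z \<in> X' then Inl (inv_into (mspace X) f z) else Inr (inv_into (mspace Y) g z))" for z
  define W where "W = X' \<union> Y'"
  define k where "k = inv_into W h"
  define d where "d u v = mdist Z (k u) (k v)" for u v
  have inj: "inj_on h W"
  proof (rule inj_onI)
    fix z w assume "z \<in> W" "w \<in> W" "h z = h w"
    moreover have "f ` mspace X = X'" "g ` mspace Y = Y'"
      using f(2) g(2) by (simp_all add: bij_betw_def)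
    ultimately show "z = w"
      by (simp add: h_def W_def split: if_splits) (metis f_inv_into_f)+
  qed
  have kh: "k (h z) = z" if "z \<in> W" for z
    using inj that by (simp add: k_def)
  have WZ: "W \<subseteq> mspace Z"
    using f g by (auto simp: W_def)
  have M: "Metric_space (h ` W) d"
  proof
    show "0 \<le> d u v" for u v
      by (simp add: d_def)
    show "d u v = d v u" for u v
      by (simp add: d_def mdist_commute)
    show "d u v = 0 \<longleftrightarrow> u = v" if "u \<in> h ` W" "v \<in> h ` W" for u v
      using that WZ by (auto simp: d_def kh subset_iff)
    show "d u w \<le> d u v + d v w" if "u \<in> h ` W" "v \<in> h ` W" "w \<in> h ` W" for u v w
      using that WZ by (auto simp: d_def kh subset_iff intro!: mdist_triangle)
  qed
  define V where "V = metric (h ` W, d)"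
  have V: "mspace V = h ` W" "mdist V = d"
    using Metric_space.mspace_metric[OF M] Metric_space.mdist_metric[OF M] by (simp_all add: V_def)
  have dh: "d (h a) (h b) = mdist Z a b" if "a \<in> W" "b \<in> W" for a b
    using that kh by (simp add: d_def)
  have fX: "f x \<in> W" if "x \<in> mspace X" for x
    using that f(2) by (auto simp: W_def bij_betw_def)
  have gY: "g x \<in> W" if "x \<in> mspace Y" for x
    using that g(2) by (auto simp: W_def bij_betw_def)
  have "bij_betw (h \<circ> f) (mspace X) (h ` X')"
    using f(2) inj by (intro bij_betw_trans[OF f(2)]) (auto simp: W_def bij_betw_def inj_on_Un)
  then have 1: "isometric_to_subset X V (h ` X')"
    unfolding isometric_to_subset_def V using f(3) dh fX
    by (auto simp: W_def intro!: exI[of _ "h \<circ> f"])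
  have "bij_betw (h \<circ> g) (mspace Y) (h ` Y')"
    using g(2) inj by (intro bij_betw_trans[OF g(2)]) (auto simp: W_def bij_betw_def inj_on_Un)
  then have 2: "isometric_to_subset Y V (h ` Y')"
    unfolding isometric_to_subset_def V using g(3) dh gY
    by (auto simp: W_def intro!: exI[of _ "h \<circ> g"])
  have "hausdorff_dist V (h ` X') (h ` Y') = hausdorff_dist Z X' Y'"
    unfolding hausdorff_dist_def V image_image
    by (intro arg_cong2[where f = max] SUP_cong INF_cong refl) (auto simp: dh W_def)
  with r have 3: "hausdorff_dist V (h ` X') (h ` Y') \<le> ereal r"
    by simp
  show ?thesis
    unfolding gromov_hausdorff_dist_def using 1 2 3 by (intro Inf_lower) blast
qed

definition smaller_diameter_partition :: "'a metric \<Rightarrow> 'a set set \<Rightarrow> bool" where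
  "smaller_diameter_partition Y P \<longleftrightarrow> partition_on (mspace Y) P \<and>
     (\<exists>\<epsilon>>0. \<forall>S\<in>P. mdiameter Y S \<le> mdiameter Y (mspace Y) - \<epsilon>)"

text \<open>The Borsuk number is a cardinal, possibly infinite, represented as usual by a cardinal order;
  it is determined up to \<open>=o\<close>.\<close>

definition borsuk_number :: "'a metric \<Rightarrow> 'a set rel" where
  "borsuk_number Y =
     (SOME \<kappa>. \<kappa> \<in> {|P| | P. smaller_diameter_partition Y P} \<and>
             (\<forall>\<kappa>'\<in>{|P| | P. smaller_diameter_partition Y P}. \<kappa> \<le>o \<kappa>'))"

lemma borsuk_number_minimal:
  assumes bdd: "mbounded_of Y (mspace Y)" and two: "ctwo \<le>o |mspace Y|"
  shows "\<exists>P. smaller_diameter_partition Y P \<and> borsuk_number Y = |P|"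
    and "smaller_diameter_partition Y P \<Longrightarrow> borsuk_number Y \<le>o |P|"
proof -
  obtain e :: "bool \<Rightarrow> 'a" where e: "inj e" "range e \<subseteq> mspace Y"
    using two unfolding ctwo_def card_of_ordLeq[symmetric] by blast
  obtain B where B: "\<forall>x\<in>mspace Y. \<forall>y\<in>mspace Y. mdist Y x y \<le> B"
    using bdd unfolding mbounded_of_def Metric_space.mbounded_alt[OF Metric_space_mspace_mdist]
    by blast
  have eY: "e True \<in> mspace Y" "e False \<in> mspace Y" "e True \<noteq> e False"
    using e by (auto dest: injD)
  then have "0 < mdist Y (e True) (e False)"
    by (metis mdist_nonneg mdist_zero order_le_less)
  also have "\<dots> \<le> (SUP (x, y)\<in>mspace Y \<times> mspace Y. mdist Y x y)"
    using eY B by (intro cSUP_upper2[where x = "(e True, e False)"] bdd_aboveI2[where M = B]) auto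
  also have "\<dots> = mdiameter Y (mspace Y)"
    using eY by (auto simp: mdiameter_def)
  finally have pos: "0 < mdiameter Y (mspace Y)" .
  have "smaller_diameter_partition Y ((\<lambda>y. {y}) ` mspace Y)"
    unfolding smaller_diameter_partition_def
  proof (intro conjI exI[of _ "mdiameter Y (mspace Y)"] pos)
    show "partition_on (mspace Y) ((\<lambda>y. {y}) ` mspace Y)"
      by (auto simp: partition_on_def disjoint_def)
  qed (auto simp: mdiameter_def mdist_zero[THEN iffD2, OF _ _ refl])
  then have "\<exists>\<kappa>\<in>{|P| | P. smaller_diameter_partition Y P}.
               \<forall>\<kappa>'\<in>{|P| | P. smaller_diameter_partition Y P}. \<kappa> \<le>o \<kappa>'"
    by (intro exists_minim_Card_order) (auto simp: card_of_Card_order)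
  then have *: "borsuk_number Y \<in> {|P| | P. smaller_diameter_partition Y P} \<and>
      (\<forall>\<kappa>'\<in>{|P| | P. smaller_diameter_partition Y P}. borsuk_number Y \<le>o \<kappa>')"
    unfolding borsuk_number_def Bex_def by (rule someI_ex)
  from * show "\<exists>P. smaller_diameter_partition Y P \<and> borsuk_number Y = |P|"
    by blast
  from * show "smaller_diameter_partition Y P \<Longrightarrow> borsuk_number Y \<le>o |P|"
    by blast
qed

end

theory Submission
  imports Defs
begin

text \<open>Write \<open>D\<close> for the diameter of \<open>Y\<close>. Gluing \<open>X\<close> and \<open>Y\<close> with all cross distances equal to
  \<open>D / 2\<close> gives a metric because \<open>diam X \<le> D\<close>, so the Gromov--Hausdorff distance is at most
  \<open>D / 2\<close>. If it were smaller, some \<open>s < D / 2\<close> would allow us to send every point of \<open>Y\<close> to a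
  point of \<open>X\<close> at distance below \<open>s\<close>; the fibres of this map partition \<open>Y\<close> into at most \<open>#X\<close>
  sets of diameter at most \<open>2 s < D\<close>, contradicting \<open>#X < \<beta>(Y)\<close>.\<close>

lemma mdist_le_mdiameter:
  assumes bdd: "mbounded_of X (mspace X)" and xy: "x \<in> mspace X" "y \<in> mspace X"
  shows "mdist X x y \<le> mdiameter X (mspace X)"
proof -
  obtain B where B: "\<forall>x\<in>mspace X. \<forall>y\<in>mspace X. mdist X x y \<le> B"
    using bdd unfolding mbounded_of_def Metric_space.mbounded_alt[OF Metric_space_mspace_mdist]
    by blast
  have "mdist X x y \<le> (SUP (x, y)\<in>mspace X \<times> mspace X. mdist X x y)"
    using xy B by (intro cSUP_upper2[where x = "(x, y)"] bdd_aboveI2[where M = B]) auto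
  also have "\<dots> = mdiameter X (mspace X)"
    using xy by (auto simp: mdiameter_def)
  finally show ?thesis .
qed

lemma mdiameter_le:
  assumes "S \<noteq> {}" and "\<And>x y. x \<in> S \<Longrightarrow> y \<in> S \<Longrightarrow> mdist X x y \<le> B"
  shows "mdiameter X S \<le> B"
  using assms by (auto simp: mdiameter_def intro!: cSUP_least)

lemma mdiameter_pos:
  assumes bdd: "mbounded_of Y (mspace Y)" and two: "ctwo \<le>o |mspace Y|"
  shows "0 < mdiameter Y (mspace Y)"
proof -
  \<comment> \<open>\<open>ctwo\<close> is the cardinal of \<open>bool\<close>, so the embedding
    \<open>e\<close> supplies two distinct points.\<close>
  obtain e :: "bool \<Rightarrow> 'a" where e: "inj e" "range e \<subseteq> mspace Y"
    using two unfolding ctwo_def card_of_ordLeq[symmetric] by blast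
  have eY: "e True \<in> mspace Y" "e False \<in> mspace Y" "e True \<noteq> e False"
    using e by (auto dest: injD)
  then have "0 < mdist Y (e True) (e False)"
    by (metis mdist_nonneg mdist_zero order_le_less)
  also have "\<dots> \<le> mdiameter Y (mspace Y)"
    by (rule mdist_le_mdiameter[OF bdd eY(1,2)])
  finally show ?thesis .
qed

fun glued_dist :: "real \<Rightarrow> 'a metric \<Rightarrow> 'b metric \<Rightarrow> 'a + 'b \<Rightarrow> 'a + 'b \<Rightarrow> real" where
  "glued_dist c X Y (Inl x) (Inl x') = mdist X x x'"
| "glued_dist c X Y (Inr y) (Inr y') = mdist Y y y'"
| "glued_dist c X Y (Inl x) (Inr y) = c"
| "glued_dist c X Y (Inr y) (Inl x) = c"

text \<open>Within one summand the triangle inequality is inherited. The critical case has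
  \<open>u\<close> and \<open>w\<close> in one summand and \<open>v\<close> in the other: the detour
  costs \<open>2 * c\<close>, which the bounds on \<open>X\<close> and \<open>Y\<close> allow.
  Positivity of \<open>c\<close> keeps points of different summands apart.\<close>

lemma Metric_space_glued_dist:
  assumes c: "0 < c"
    and X: "\<And>x x'. x \<in> mspace X \<Longrightarrow> x' \<in> mspace X \<Longrightarrow> mdist X x x' \<le> 2 * c"
    and Y: "\<And>y y'. y \<in> mspace Y \<Longrightarrow> y' \<in> mspace Y \<Longrightarrow> mdist Y y y' \<le> 2 * c"
  shows "Metric_space (mspace X <+> mspace Y) (glued_dist c X Y)"
proof
  show "0 \<le> glued_dist c X Y u v" for u v
    using c by (cases u; cases v) auto
  show "glued_dist c X Y u v = glued_dist c X Y v u" for u v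
    by (cases u; cases v) (auto simp: mdist_commute)
  show "glued_dist c X Y u v = 0 \<longleftrightarrow> u = v"
    if "u \<in> mspace X <+> mspace Y" "v \<in> mspace X <+> mspace Y" for u v
    using that c by auto
  show "glued_dist c X Y u w \<le> glued_dist c X Y u v + glued_dist c X Y v w"
    if "u \<in> mspace X <+> mspace Y" "v \<in> mspace X <+> mspace Y" "w \<in> mspace X <+> mspace Y"
    for u v w
    using that X Y by (auto simp: mdist_triangle)
qed

lemma gromov_hausdorff_dist_le_half_diameter:
  fixes X :: "'a metric" and Y :: "'b metric"
  assumes ne: "mspace X \<noteq> {}" "mspace Y \<noteq> {}" and c: "0 < c"
    and X: "\<And>x x'. x \<in> mspace X \<Longrightarrow> x' \<in> mspace X \<Longrightarrow> mdist X x x' \<le> 2 * c"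
    and Y: "\<And>y y'. y \<in> mspace Y \<Longrightarrow> y' \<in> mspace Y \<Longrightarrow> mdist Y y y' \<le> 2 * c"
  shows "gromov_hausdorff_dist X Y \<le> ereal c"
proof -
  define Z where "Z = metric (mspace X <+> mspace Y, glued_dist c X Y)"
  have M: "Metric_space (mspace X <+> mspace Y) (glued_dist c X Y)"
    using c X Y by (rule Metric_space_glued_dist)
  have Z: "mspace Z = mspace X <+> mspace Y" "mdist Z = glued_dist c X Y"
    using Metric_space.mspace_metric[OF M] Metric_space.mdist_metric[OF M] by (simp_all add: Z_def)
  have "isometric_to_subset X Z (Inl ` mspace X)"
    unfolding isometric_to_subset_def Z by (auto intro!: exI[of _ Inl] simp: bij_betw_def)
  moreover have "isometric_to_subset Y Z (Inr ` mspace Y)"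
    unfolding isometric_to_subset_def Z by (auto intro!: exI[of _ Inr] simp: bij_betw_def)
  \<comment> \<open>All cross distances equal \<open>c\<close>; as both carriers are nonempty, the
    infima and suprema of this constant are \<open>c\<close>.\<close>
  moreover have "hausdorff_dist Z (Inl ` mspace X) (Inr ` mspace Y) \<le> ereal c"
    using ne by (simp add: hausdorff_dist_def Z image_image)
  ultimately show ?thesis
    by (rule gromov_hausdorff_dist_le)
qed

text \<open>The gap between the diameter of \<open>Y\<close> and \<open>2 * s\<close> serves all
  fibres at once as the uniform \<epsilon>. Indexing by the image of \<open>\<phi>\<close> rules out
  empty fibres.\<close>

lemma smaller_diameter_partition_fibres:
  assumes s: "2 * s < mdiameter Y (mspace Y)"
    and fibre: "\<And>y y'. y \<in> mspace Y \<Longrightarrow> y' \<in> mspace Y \<Longrightarrow> \<phi> y = \<phi> y' \<Longrightarrow> mdist Y y y' \<le> 2 * s"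
  shows "smaller_diameter_partition Y ((\<lambda>x. {y \<in> mspace Y. \<phi> y = x}) ` \<phi> ` mspace Y)"
    (is "smaller_diameter_partition Y ?P")
  unfolding smaller_diameter_partition_def
proof (intro conjI exI[of _ "mdiameter Y (mspace Y) - 2 * s"] ballI)
  show "partition_on (mspace Y) ?P"
    by (auto simp: partition_on_def disjoint_def)
  show "0 < mdiameter Y (mspace Y) - 2 * s"
    using s by simp
  show "mdiameter Y S \<le> mdiameter Y (mspace Y) - (mdiameter Y (mspace Y) - 2 * s)" if "S \<in> ?P" for S
    using that fibre by (auto intro!: mdiameter_le)
qed

lemma half_diameter_le_hausdorff_dist:
  fixes X :: "'a metric" and Y :: "'b metric" and Z :: "'c metric"
  assumes bdd: "mbounded_of Y (mspace Y)" and two: "ctwo \<le>o |mspace Y|"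
    and card: "|mspace X| <o borsuk_number Y"
    and X': "isometric_to_subset X Z X'" and Y': "isometric_to_subset Y Z Y'"
    and r: "hausdorff_dist Z X' Y' \<le> ereal r"
  shows "mdiameter Y (mspace Y) / 2 \<le> r"
proof (rule ccontr)
  assume "\<not> mdiameter Y (mspace Y) / 2 \<le> r"
  \<comment> \<open>The slack \<open>r < s\<close> copes with infima that are not attained; the
    other inequality leaves a positive gap for the partition.\<close>
  then obtain s where s: "r < s" "s < mdiameter Y (mspace Y) / 2"
    using dense[of r "mdiameter Y (mspace Y) / 2"] by auto
  obtain f where f: "X' \<subseteq> mspace Z" "bij_betw f (mspace X) X'"
    using X' unfolding isometric_to_subset_def by blast
  obtain g where g: "Y' \<subseteq> mspace Z" "bij_betw g (mspace Y) Y'"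
    "\<And>y y'. y \<in> mspace Y \<Longrightarrow> y' \<in> mspace Y \<Longrightarrow> mdist Z (g y) (g y') = mdist Y y y'"
    using Y' unfolding isometric_to_subset_def by blast
  have gY: "g y \<in> Y'" if "y \<in> mspace Y" for y
    using that g(2) by (auto simp: bij_betw_def)
  have "\<exists>a\<in>X'. mdist Z a (g y) < s" if "y \<in> mspace Y" for y
  proof -
    \<comment> \<open>This is the half of the Hausdorff distance that controls how far points of
      \<open>Y'\<close> lie from \<open>X'\<close>.\<close>
    have "(INF a\<in>X'. ereal (mdist Z a (g y))) \<le> (SUP b\<in>Y'. INF a\<in>X'. ereal (mdist Z a b))"
      using gY[OF that] by (rule SUP_upper)
    also have "\<dots> \<le> ereal r"
      using r by (simp add: hausdorff_dist_def)
    also have "\<dots> < ereal s"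
      using s by simp
    finally show ?thesis
      by (simp add: INF_less_iff)
  qed
  then obtain \<phi> where \<phi>: "\<And>y. y \<in> mspace Y \<Longrightarrow> \<phi> y \<in> X' \<and> mdist Z (\<phi> y) (g y) < s"
    by metis
  have fibre: "mdist Y y y' \<le> 2 * s"
    if "y \<in> mspace Y" "y' \<in> mspace Y" "\<phi> y = \<phi> y'" for y y'
  proof -
    \<comment> \<open>The detour goes through the common value \<open>\<phi> y = \<phi> y'\<close>
      in \<open>X'\<close>.\<close>
    have "mdist Z (g y) (g y') \<le> mdist Z (g y) (\<phi> y) + mdist Z (\<phi> y) (g y')"
      using that gY \<phi> f(1) g(1) by (intro mdist_triangle) auto
    also have "\<dots> \<le> 2 * s"
      using \<phi>[OF that(1)] \<phi>[OF that(2)] that(3) by (simp add: mdist_commute)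
    finally show ?thesis
      using g(3) that by simp
  qed
  define P where "P = (\<lambda>x. {y \<in> mspace Y. \<phi> y = x}) ` \<phi> ` mspace Y"
  have "smaller_diameter_partition Y P"
    unfolding P_def using s fibre by (intro smaller_diameter_partition_fibres) auto
  \<comment> \<open>Nonempty fibres are indexed by points of \<open>X'\<close>, a copy of
    \<open>X\<close>, which caps their number.\<close>
  then have "borsuk_number Y \<le>o |P|"
    by (rule borsuk_number_minimal(2)[OF bdd two])
  also have "|P| \<le>o |\<phi> ` mspace Y|"
    unfolding P_def by (rule card_of_image)
  also have "|\<phi> ` mspace Y| \<le>o |X'|"
    using \<phi> by (intro card_of_mono1) auto
  also have "|X'| \<le>o |mspace X|"
    using f(2) card_of_image[of f "mspace X"] by (simp add: bij_betw_def)
  finally show False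
    using card not_ordLess_ordLeq by blast
qed

theorem theorem4p1:
  fixes X :: "'a metric" and Y :: "'b metric"
  assumes "mspace X \<noteq> {}"
    and "mbounded_of X (mspace X)"
    and "mbounded_of Y (mspace Y)"
    and "ctwo \<le>o |mspace Y|"
    and "|mspace X| <o borsuk_number Y"
    and "mdiameter X (mspace X) \<le> mdiameter Y (mspace Y)"
  shows "2 * gromov_hausdorff_dist X Y = ereal (mdiameter Y (mspace Y))"
proof -
  define D where "D = mdiameter Y (mspace Y)"
  have pos: "0 < D"
    unfolding D_def using assms(3,4) by (rule mdiameter_pos)
  \<comment> \<open>The empty set has diameter 0 by convention, so positivity of \<open>D\<close>
    excludes it.\<close>
  then have "mspace Y \<noteq> {}"
    by (auto simp: D_def mdiameter_def)
  then have "gromov_hausdorff_dist X Y \<le> ereal (D / 2)"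
    using assms(1) pos mdist_le_mdiameter[OF assms(3)]
      order_trans[OF mdist_le_mdiameter[OF assms(2)] assms(6)]
    by (intro gromov_hausdorff_dist_le_half_diameter) (auto simp: D_def)
  moreover have "ereal (D / 2) \<le> gromov_hausdorff_dist X Y"
    unfolding gromov_hausdorff_dist_def D_def
    using half_diameter_le_hausdorff_dist[OF assms(3-5)] by (intro Inf_greatest) auto
  ultimately have "gromov_hausdorff_dist X Y = ereal (D / 2)"
    by (rule antisym)
  \<comment> \<open>Reading the numeral as \<open>ereal 2\<close> turns the product into one of
    reals.\<close>
  then have "2 * gromov_hausdorff_dist X Y = ereal 2 * ereal (D / 2)"
    by simp
  then show ?thesis
    by (simp add: D_def)
qed

end
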